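(* Let $L$ be a left pre-Lie algebra over a field $F$, and let $B$, $C$ be ideals of $L$ such that $L = B + C$. If $B^{(3)} = C^{(3)} = \langle 0\rangle$, then $B\cap C$ includes an abelian ideal $J$ of $L$ such that $(L/J)^{(6)} = \langle 0\rangle$.
   Context: A left pre-Lie algebra over a field $F$ is an $F$-vector space $L$ with a bilinear product $\cdot$ satisfying $(x\cdot y)\cdot z - x\cdot(y\cdot z) = (y\cdot x)\cdot z - y\cdot(x\cdot z)$ for all $x,y,z\in L$. An ideal of $L$ is a two-sided ideal (a subspace $I$ with $x\cdot a, a\cdot x\in I$ for all $x \in L$, $a\in I$). For subspaces $U,V$ of $L$, $U\cdot V$ denotes the subspace spanned by all products $u\cdot v$ with $u\in U$, $v\in V$. For a pre-Lie algebra $A$ (in particular for an ideal of $L$, regarded as an algebra in its own right) put $A^{(1)} = A$ and $A^{(n+1)} = A^{(n)}\cdot A$ for all positive integers $n$. $A$ is abelian if $x\cdot y = 0$ for all $x,y\in A$. $\langle 0\rangle$ denotes the zero subspace. *)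

theory Defs
  imports HOL.Hull "HOL-Algebra.Module" "HOL-Algebra.QuotRing"
begin

text \<open>
  A (nonassociative) algebra over a field is carried by the record type of modules: it
  inherits a product \<open>mult\<close> from the ring record, and no associativity or
  unit law is imposed on it.  The field \<open>one\<close> of the record plays no role.
\<close>

locale left_pre_lie_algebra = module F L + field F
  for F (structure) and L (structure) +
  assumes prod_closed:
      "\<lbrakk>x \<in> carrier L; y \<in> carrier L\<rbrakk> \<Longrightarrow> x \<otimes>\<^bsub>L\<^esub> y \<in> carrier L"
    and prod_add_left:
      "\<lbrakk>x \<in> carrier L; y \<in> carrier L; z \<in> carrier L\<rbrakk>
        \<Longrightarrow> (x \<oplus>\<^bsub>L\<^esub> y) \<otimes>\<^bsub>L\<^esub> z = (x \<otimes>\<^bsub>L\<^esub> z) \<oplus>\<^bsub>L\<^esub> (y \<otimes>\<^bsub>L\<^esub> z)"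
    and prod_add_right:
      "\<lbrakk>x \<in> carrier L; y \<in> carrier L; z \<in> carrier L\<rbrakk>
        \<Longrightarrow> x \<otimes>\<^bsub>L\<^esub> (y \<oplus>\<^bsub>L\<^esub> z) = (x \<otimes>\<^bsub>L\<^esub> y) \<oplus>\<^bsub>L\<^esub> (x \<otimes>\<^bsub>L\<^esub> z)"
    and prod_smult_left:
      "\<lbrakk>a \<in> carrier F; x \<in> carrier L; y \<in> carrier L\<rbrakk>
        \<Longrightarrow> (a \<odot>\<^bsub>L\<^esub> x) \<otimes>\<^bsub>L\<^esub> y = a \<odot>\<^bsub>L\<^esub> (x \<otimes>\<^bsub>L\<^esub> y)"
    and prod_smult_right:
      "\<lbrakk>a \<in> carrier F; x \<in> carrier L; y \<in> carrier L\<rbrakk>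
        \<Longrightarrow> x \<otimes>\<^bsub>L\<^esub> (a \<odot>\<^bsub>L\<^esub> y) = a \<odot>\<^bsub>L\<^esub> (x \<otimes>\<^bsub>L\<^esub> y)"
    and left_symmetric:
      "\<lbrakk>x \<in> carrier L; y \<in> carrier L; z \<in> carrier L\<rbrakk>
        \<Longrightarrow> ((x \<otimes>\<^bsub>L\<^esub> y) \<otimes>\<^bsub>L\<^esub> z) \<ominus>\<^bsub>L\<^esub> (x \<otimes>\<^bsub>L\<^esub> (y \<otimes>\<^bsub>L\<^esub> z))
          = ((y \<otimes>\<^bsub>L\<^esub> x) \<otimes>\<^bsub>L\<^esub> z) \<ominus>\<^bsub>L\<^esub> (y \<otimes>\<^bsub>L\<^esub> (x \<otimes>\<^bsub>L\<^esub> z))"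

definition alg_ideal ::
    "('a, 'm) ring_scheme \<Rightarrow> ('a, 'b, 'n) module_scheme \<Rightarrow> 'b set \<Rightarrow> bool" where
  "alg_ideal F L I \<longleftrightarrow> submodule I F L \<and>
     (\<forall>x\<in>carrier L. \<forall>a\<in>I. x \<otimes>\<^bsub>L\<^esub> a \<in> I \<and> a \<otimes>\<^bsub>L\<^esub> x \<in> I)"

definition prod_span ::
    "('a, 'm) ring_scheme \<Rightarrow> ('a, 'b, 'n) module_scheme \<Rightarrow> 'b set \<Rightarrow> 'b set \<Rightarrow> 'b set" where
  "prod_span F L U V = (\<lambda>W. submodule W F L) hull {u \<otimes>\<^bsub>L\<^esub> v |u v. u \<in> U \<and> v \<in> V}"

text \<open>
  \<open>right_power F A n\<close> is the power \<open>A\<^bsup>(n)\<^esup>\<close> of the algebra \<open>A\<close>, so that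
  \<open>A\<^bsup>(1)\<^esup> = A\<close>; the value at \<open>n = 0\<close> is a dummy.
\<close>

fun right_power ::
    "('a, 'm) ring_scheme \<Rightarrow> ('a, 'b, 'n) module_scheme \<Rightarrow> nat \<Rightarrow> 'b set" where
  "right_power F A 0 = carrier A"
| "right_power F A (Suc 0) = carrier A"
| "right_power F A (Suc (Suc n)) = prod_span F A (right_power F A (Suc n)) (carrier A)"

definition abelian_alg :: "('a, 'b, 'n) module_scheme \<Rightarrow> bool" where
  "abelian_alg A \<longleftrightarrow> (\<forall>x\<in>carrier A. \<forall>y\<in>carrier A. x \<otimes>\<^bsub>A\<^esub> y = \<zero>\<^bsub>A\<^esub>)"

text \<open>
  The operations on cosets are those of the library's quotient ring; in particular
  \<open>rcoset_mult\<close> sends \<open>J + x\<close> and \<open>J + y\<close> to \<open>J + x \<cdot> y\<close>, the union over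
  representatives being constant when \<open>J\<close> is an ideal.  Scalar multiplication is
  defined in the same style.
\<close>

definition quotient_alg ::
    "('a, 'b, 'n) module_scheme \<Rightarrow> 'b set \<Rightarrow> ('a, 'b set) module" where
  "quotient_alg L J =
     \<lparr>carrier = a_rcosets\<^bsub>L\<^esub> J, mult = rcoset_mult L J, one = J +>\<^bsub>L\<^esub> \<one>\<^bsub>L\<^esub>,
      zero = J, add = set_add L, smult = (\<lambda>a X. \<Union>x\<in>X. J +>\<^bsub>L\<^esub> (a \<odot>\<^bsub>L\<^esub> x))\<rparr>"

end

theory Submission
  imports Defs
begin

text \<open>
  Put \<open>D = B \<inter> C\<close> and take \<open>J = D \<cdot> L\<close>.  Left symmetry makes the product of an ideal
  with \<open>L\<close> an ideal.  Since \<open>(B \<cdot> B) \<cdot> B = (C \<cdot> C) \<cdot> C = 0\<close> and \<open>L = B + C\<close>, splitting the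
  middle factor gives \<open>(D \<cdot> L) \<cdot> D = 0\<close>, so \<open>J\<close> is abelian.  Splitting all three factors of
  \<open>(x \<cdot> y) \<cdot> z\<close> gives \<open>L\<^bsup>(3)\<^esup> \<subseteq> D\<close>: a product with factors from both \<open>B\<close> and \<open>C\<close> lies in
  \<open>D\<close>, and the others vanish.  Hence already \<open>L\<^bsup>(4)\<^esup> \<subseteq> J\<close>.
\<close>

section \<open>Product spans and powers\<close>

lemma prod_span_minimal:
  assumes "submodule W F L"
    and "\<And>u v. u \<in> U \<Longrightarrow> v \<in> V \<Longrightarrow> u \<otimes>\<^bsub>L\<^esub> v \<in> W"
  shows "prod_span F L U V \<subseteq> W"
  unfolding prod_span_def using assms by (intro hull_minimal) auto

lemma prod_in_prod_span:
  "u \<in> U \<Longrightarrow> v \<in> V \<Longrightarrow> u \<otimes>\<^bsub>L\<^esub> v \<in> prod_span F L U V"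
  unfolding prod_span_def by (rule hull_inc) blast

text \<open>Every submodule contains zero, whatever \<open>F\<close> and \<open>L\<close> are, so
  this applies directly to the quotient algebra and yields the inclusion of zero in its
  powers.\<close>

lemma zero_in_prod_span: "\<zero>\<^bsub>L\<^esub> \<in> prod_span F L U V"
  unfolding prod_span_def hull_def
  using subgroup.one_closed[OF submodule.axioms(1), of _ F L] by auto

text \<open>Updating the carrier leaves the product unchanged, so the vanishing third power of the
  subalgebra becomes an elementwise identity in \<open>L\<close>.\<close>

lemma right_power_3_trivial:
  assumes "right_power F (L\<lparr>carrier := B\<rparr>) 3 = {\<zero>\<^bsub>L\<^esub>}"
    and "x \<in> B" "y \<in> B" "z \<in> B"
  shows "(x \<otimes>\<^bsub>L\<^esub> y) \<otimes>\<^bsub>L\<^esub> z = \<zero>\<^bsub>L\<^esub>"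
proof -
  let ?B = "L\<lparr>carrier := B\<rparr>"
  have "(x \<otimes>\<^bsub>?B\<^esub> y) \<otimes>\<^bsub>?B\<^esub> z \<in> right_power F ?B (Suc (Suc (Suc 0)))"
    using assms(2-4) by (simp only: right_power.simps) (intro prod_in_prod_span; simp)
  then show ?thesis using assms(1) by (simp add: numeral_3_eq_3)
qed

lemma alg_idealD:
  assumes "alg_ideal F L I"
  shows "submodule I F L" "\<And>x a. x \<in> carrier L \<Longrightarrow> a \<in> I \<Longrightarrow> x \<otimes>\<^bsub>L\<^esub> a \<in> I"
    "\<And>x a. x \<in> carrier L \<Longrightarrow> a \<in> I \<Longrightarrow> a \<otimes>\<^bsub>L\<^esub> x \<in> I"
  using assms unfolding alg_ideal_def by auto

section \<open>Subspaces and products\<close>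

context left_pre_lie_algebra
begin

text \<open>Negation is scaling by -1, so closure under it follows from closure under
  scalars.\<close>

lemma submoduleI_no_inv:
  assumes "H \<subseteq> carrier L" "\<zero>\<^bsub>L\<^esub> \<in> H"
    and "\<And>x y. x \<in> H \<Longrightarrow> y \<in> H \<Longrightarrow> x \<oplus>\<^bsub>L\<^esub> y \<in> H"
    and "\<And>a x. a \<in> carrier F \<Longrightarrow> x \<in> H \<Longrightarrow> a \<odot>\<^bsub>L\<^esub> x \<in> H"
  shows "submodule H F L"
proof (rule submoduleI)
  fix x assume x: "x \<in> H"
  then have "\<ominus>\<^bsub>L\<^esub> x = (\<ominus>\<^bsub>F\<^esub> \<one>\<^bsub>F\<^esub>) \<odot>\<^bsub>L\<^esub> x"
    using assms(1) smult_l_minus[of "\<one>\<^bsub>F\<^esub>" x] by (auto simp: subset_iff)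
  then show "\<ominus>\<^bsub>L\<^esub> x \<in> H" using assms(4) x by simp
qed (use assms in auto)

lemma submodule_zero_closed: "submodule W F L \<Longrightarrow> \<zero>\<^bsub>L\<^esub> \<in> W"
  using subgroup.one_closed[OF submodule.axioms(1), of W F L] by simp

lemma submodule_minus_closed:
  "submodule W F L \<Longrightarrow> x \<in> W \<Longrightarrow> y \<in> W \<Longrightarrow> x \<ominus>\<^bsub>L\<^esub> y \<in> W"
  by (simp add: a_minus_def submoduleE)

lemma submodule_zero: "submodule {\<zero>\<^bsub>L\<^esub>} F L"
  by (rule submoduleI_no_inv) auto

text \<open>Nonemptiness matters: the intersection of the empty family is the whole type, which need
  not lie in \<open>carrier L\<close>.\<close>

lemma submodule_Inter:
  assumes "\<S> \<noteq> {}" "\<And>W. W \<in> \<S> \<Longrightarrow> submodule W F L"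
  shows "submodule (\<Inter>\<S>) F L"
  using assms
  by (intro submoduleI_no_inv)
    (auto intro: submodule_zero_closed submoduleE(4,5) dest: submoduleE(1))

lemma prod_zero_left: "y \<in> carrier L \<Longrightarrow> \<zero>\<^bsub>L\<^esub> \<otimes>\<^bsub>L\<^esub> y = \<zero>\<^bsub>L\<^esub>"
  using prod_smult_left[of "\<zero>\<^bsub>F\<^esub>" "\<zero>\<^bsub>L\<^esub>" y] prod_closed[of "\<zero>\<^bsub>L\<^esub>" y] by simp

lemma prod_zero_right: "y \<in> carrier L \<Longrightarrow> y \<otimes>\<^bsub>L\<^esub> \<zero>\<^bsub>L\<^esub> = \<zero>\<^bsub>L\<^esub>"
  using prod_smult_right[of "\<zero>\<^bsub>F\<^esub>" y "\<zero>\<^bsub>L\<^esub>"] prod_closed[of y "\<zero>\<^bsub>L\<^esub>"] by simp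

text \<open>Linearity of the product in each factor gives this lemma and its mirror image. With
  \<open>prod_span_minimal\<close> they reduce a claim about products with elements of a span to one
  about the generators of the span.\<close>

lemma submodule_left_transporter:
  assumes "submodule W F L" "V \<subseteq> carrier L"
  shows "submodule {x \<in> carrier L. \<forall>v\<in>V. x \<otimes>\<^bsub>L\<^esub> v \<in> W} F L"
  using assms
  by (intro submoduleI_no_inv)
    (auto simp: prod_zero_left prod_add_left prod_smult_left subset_iff
      submodule_zero_closed submoduleE(4,5))

lemma submodule_right_transporter:
  assumes "submodule W F L" "V \<subseteq> carrier L"
  shows "submodule {x \<in> carrier L. \<forall>v\<in>V. v \<otimes>\<^bsub>L\<^esub> x \<in> W} F L"
  using assms
  by (intro submoduleI_no_inv)
    (auto simp: prod_zero_right prod_add_right prod_smult_right subset_iff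
      submodule_zero_closed submoduleE(4,5))

lemma prod_span_submodule:
  assumes "U \<subseteq> carrier L" "V \<subseteq> carrier L"
  shows "submodule (prod_span F L U V) F L"
  unfolding prod_span_def hull_def
proof (rule submodule_Inter)
  show "{t. submodule t F L \<and> {u \<otimes>\<^bsub>L\<^esub> v |u v. u \<in> U \<and> v \<in> V} \<subseteq> t} \<noteq> {}"
    using assms carrier_is_submodule by (auto intro!: exI[of _ "carrier L"] prod_closed)
qed auto

lemma right_power_submodule: "submodule (right_power F L n) F L"
proof (cases n)
  case (Suc m)
  have "submodule (right_power F L (Suc m)) F L"
    by (induction m) (simp_all add: carrier_is_submodule prod_span_submodule submoduleE(1))
  then show ?thesis using Suc by simp
qed (simp add: carrier_is_submodule)

section \<open>Ideals and the product of an ideal with L\<close>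

lemma alg_ideal_Int:
  assumes "alg_ideal F L I" "alg_ideal F L K"
  shows "alg_ideal F L (I \<inter> K)"
  using assms submodule_Inter[of "{I, K}"] unfolding alg_ideal_def by auto

lemma alg_ideal_prod_carrier_subset:
  assumes "alg_ideal F L I"
  shows "prod_span F L I (carrier L) \<subseteq> I"
  using assms by (intro prod_span_minimal) (auto dest: alg_idealD)

lemma alg_ideal_prod_carrier:
  assumes "alg_ideal F L I"
  shows "alg_ideal F L (prod_span F L I (carrier L))" (is "alg_ideal F L ?J")
proof -
  note I = alg_idealD[OF assms]
  have IL: "I \<subseteq> carrier L" using I(1) submoduleE(1) by blast
  have J: "submodule ?J F L" by (rule prod_span_submodule) (use IL in auto)
  have "x \<otimes>\<^bsub>L\<^esub> (i \<otimes>\<^bsub>L\<^esub> l) \<in> ?J" if x: "x \<in> carrier L" and i: "i \<in> I" and l: "l \<in> carrier L" for x i l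
  proof -
    have iL: "i \<in> carrier L" using i IL by auto
    let ?p = "(x \<otimes>\<^bsub>L\<^esub> i) \<otimes>\<^bsub>L\<^esub> l" and ?q = "(i \<otimes>\<^bsub>L\<^esub> x) \<otimes>\<^bsub>L\<^esub> l"
      and ?r = "i \<otimes>\<^bsub>L\<^esub> (x \<otimes>\<^bsub>L\<^esub> l)" and ?s = "x \<otimes>\<^bsub>L\<^esub> (i \<otimes>\<^bsub>L\<^esub> l)"
    have c: "?p \<in> carrier L" "?q \<in> carrier L" "?r \<in> carrier L" "?s \<in> carrier L"
      using x iL l by (simp_all add: prod_closed)
    \<comment> \<open>This brings in the associator of x, i, l. Left symmetry exchanges it for that
      of i, x, l, and then each term is an element of I times an element of L.\<close>
    have "?s = ?p \<ominus>\<^bsub>L\<^esub> (?p \<ominus>\<^bsub>L\<^esub> ?s)"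
      using c by (simp add: a_minus_def M.minus_add M.r_neg1 M.add.m_assoc[symmetric] M.r_neg)
    also have "\<dots> = ?p \<ominus>\<^bsub>L\<^esub> (?q \<ominus>\<^bsub>L\<^esub> ?r)"
      using left_symmetric[OF x iL l] by simp
    also have "\<dots> \<in> ?J"
      using x i l I(2,3) J
      by (intro submodule_minus_closed prod_in_prod_span) (auto intro: prod_closed)
    finally show ?thesis .
  qed
  \<comment> \<open>The right transporter extends left absorption from the generators to the
    span.\<close>
  then have "?J \<subseteq> {a \<in> carrier L. \<forall>x\<in>carrier L. x \<otimes>\<^bsub>L\<^esub> a \<in> ?J}"
    using IL J
    by (intro prod_span_minimal submodule_right_transporter) (auto intro: prod_closed)
  \<comment> \<open>Since \<open>?J\<close> lies in I, such a product is itself a generator of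
    \<open>?J\<close>.\<close>
  moreover have "a \<otimes>\<^bsub>L\<^esub> x \<in> ?J" if "x \<in> carrier L" "a \<in> ?J" for x a
    using that alg_ideal_prod_carrier_subset[OF assms] by (auto intro: prod_in_prod_span)
  ultimately show ?thesis unfolding alg_ideal_def using J by blast
qed

section \<open>The quotient algebra and its powers\<close>

lemma submodule_abelian_subgroup: "submodule J F L \<Longrightarrow> abelian_subgroup J L"
  by (intro abelian_subgroupI3 additive_subgroupI submodule.axioms(1)) (auto intro: M.abelian_group_axioms)

text \<open>Two representatives differ by some h in J, and their multiples by a \<odot> h, again in
  J; so the union in \<open>quotient_alg_def\<close> is over equal cosets.\<close>

lemma quotient_alg_smult:
  assumes "submodule J F L" "a \<in> carrier F" "x \<in> carrier L"
  shows "a \<odot>\<^bsub>quotient_alg L J\<^esub> (J +>\<^bsub>L\<^esub> x) = J +>\<^bsub>L\<^esub> (a \<odot>\<^bsub>L\<^esub> x)"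
proof -
  interpret J: abelian_subgroup J L using assms(1) by (rule submodule_abelian_subgroup)
  have "J +>\<^bsub>L\<^esub> (a \<odot>\<^bsub>L\<^esub> y) = J +>\<^bsub>L\<^esub> (a \<odot>\<^bsub>L\<^esub> x)" if y: "y \<in> J +>\<^bsub>L\<^esub> x" for y
  proof -
    obtain h where h: "h \<in> J" "y = h \<oplus>\<^bsub>L\<^esub> x" using y by (auto simp: a_r_coset_def')
    have ah: "a \<odot>\<^bsub>L\<^esub> h \<in> J" using submoduleE(4)[OF assms(1,2) h(1)] .
    have "a \<odot>\<^bsub>L\<^esub> y = a \<odot>\<^bsub>L\<^esub> h \<oplus>\<^bsub>L\<^esub> a \<odot>\<^bsub>L\<^esub> x"
      unfolding h(2) using assms(2,3) h(1) J.a_subset by (intro smult_r_distr) auto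
    then have "a \<odot>\<^bsub>L\<^esub> y \<in> J +>\<^bsub>L\<^esub> (a \<odot>\<^bsub>L\<^esub> x)"
      using ah unfolding a_r_coset_def' by blast
    then show ?thesis using assms(2,3) by (intro J.a_repr_independence'[symmetric]) auto
  qed
  moreover have "x \<in> J +>\<^bsub>L\<^esub> x" using assms(3) by (rule J.a_rcos_self)
  ultimately have "(\<Union>y\<in>J +>\<^bsub>L\<^esub> x. J +>\<^bsub>L\<^esub> (a \<odot>\<^bsub>L\<^esub> y)) = J +>\<^bsub>L\<^esub> (a \<odot>\<^bsub>L\<^esub> x)"
    by (intro UN_constant_eq) blast+
  then show ?thesis by (simp add: quotient_alg_def)
qed

lemma quotient_alg_mult:
  assumes "alg_ideal F L J" "x \<in> carrier L" "y \<in> carrier L"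
  shows "(J +>\<^bsub>L\<^esub> x) \<otimes>\<^bsub>quotient_alg L J\<^esub> (J +>\<^bsub>L\<^esub> y) = J +>\<^bsub>L\<^esub> (x \<otimes>\<^bsub>L\<^esub> y)"
proof -
  note I = alg_idealD[OF assms(1)]
  interpret J: abelian_subgroup J L using I(1) by (rule submodule_abelian_subgroup)
  have "J +>\<^bsub>L\<^esub> (x' \<otimes>\<^bsub>L\<^esub> y') = J +>\<^bsub>L\<^esub> (x \<otimes>\<^bsub>L\<^esub> y)"
    if x': "x' \<in> J +>\<^bsub>L\<^esub> x" and y': "y' \<in> J +>\<^bsub>L\<^esub> y" for x' y'
  proof -
    obtain h where h: "h \<in> J" "x' = h \<oplus>\<^bsub>L\<^esub> x" using x' by (auto simp: a_r_coset_def')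
    obtain k where k: "k \<in> J" "y' = k \<oplus>\<^bsub>L\<^esub> y" using y' by (auto simp: a_r_coset_def')
    have c: "h \<in> carrier L" "k \<in> carrier L" "y' \<in> carrier L"
      using h(1) k assms J.a_subset by auto
    \<comment> \<open>The bracketed error has one term with its J-factor on the left and one with it
      on the right, so both sides of the ideal property are used.\<close>
    have "x' \<otimes>\<^bsub>L\<^esub> y' = (h \<otimes>\<^bsub>L\<^esub> y' \<oplus>\<^bsub>L\<^esub> x \<otimes>\<^bsub>L\<^esub> k) \<oplus>\<^bsub>L\<^esub> x \<otimes>\<^bsub>L\<^esub> y"
      using c assms(2,3) unfolding h(2) k(2)
      by (simp add: prod_add_left prod_add_right prod_closed M.a_ac)
    moreover have "h \<otimes>\<^bsub>L\<^esub> y' \<oplus>\<^bsub>L\<^esub> x \<otimes>\<^bsub>L\<^esub> k \<in> J"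
      using I(2,3) h(1) k(1) c assms(2) by auto
    ultimately have "x' \<otimes>\<^bsub>L\<^esub> y' \<in> J +>\<^bsub>L\<^esub> (x \<otimes>\<^bsub>L\<^esub> y)"
      by (auto simp: a_r_coset_def')
    then show ?thesis using assms by (intro J.a_repr_independence'[symmetric]) (auto intro: prod_closed)
  qed
  moreover have "x \<in> J +>\<^bsub>L\<^esub> x" "y \<in> J +>\<^bsub>L\<^esub> y" using assms by (auto intro: J.a_rcos_self)
  ultimately have "(\<Union>a\<in>J +>\<^bsub>L\<^esub> x. \<Union>b\<in>J +>\<^bsub>L\<^esub> y. J +>\<^bsub>L\<^esub> (a \<otimes>\<^bsub>L\<^esub> b)) = J +>\<^bsub>L\<^esub> (x \<otimes>\<^bsub>L\<^esub> y)"
    by (intro UN_constant_eq) blast+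
  then show ?thesis by (simp add: quotient_alg_def rcoset_mult_def)
qed

lemma submodule_quotient_image:
  assumes J: "submodule J F L" and W: "submodule W F L"
  shows "submodule ((\<lambda>x. J +>\<^bsub>L\<^esub> x) ` W) F (quotient_alg L J)"
proof (rule submodule.intro)
  interpret J: abelian_subgroup J L using J by (rule submodule_abelian_subgroup)
  let ?Q = "add_monoid (quotient_alg L J)"
  \<comment> \<open>Being a group and being a homomorphism depend only on these three fields, so
    both facts transfer from the additive factor group.\<close>
  have eqs: "carrier ?Q = carrier (L A_Mod J)" "mult ?Q = mult (L A_Mod J)" "one ?Q = one (L A_Mod J)"
    by (simp_all add: A_FactGroup_def' quotient_alg_def)
  have "group ?Q"
    using J.a_factorgroup_is_group
    unfolding group_def monoid_def group_axioms_def Units_def eqs .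
  moreover have "(\<lambda>x. J +>\<^bsub>L\<^esub> x) \<in> hom (add_monoid L) ?Q"
    using J.a_r_coset_hom_A_Mod unfolding hom_def eqs .
  ultimately interpret group_hom "add_monoid L" ?Q "\<lambda>x. J +>\<^bsub>L\<^esub> x"
    by (intro group_hom.intro group_hom_axioms.intro M.add.group_axioms)
  show "subgroup ((\<lambda>x. J +>\<^bsub>L\<^esub> x) ` W) ?Q"
    by (rule subgroup_img_is_subgroup[OF submodule.axioms(1)[OF W]])
  show "submodule_axioms ((\<lambda>x. J +>\<^bsub>L\<^esub> x) ` W) F (quotient_alg L J)"
    using submoduleE(1,4)[OF W] by unfold_locales (auto simp: quotient_alg_smult[OF J] subset_iff)
qed

text \<open>By induction: the image of a power of L is a subspace of the quotient containing the
  generators of the corresponding power there, so minimality of the span applies.\<close>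

lemma right_power_quotient_subset:
  assumes J: "alg_ideal F L J"
  shows "right_power F (quotient_alg L J) n \<subseteq> (\<lambda>x. J +>\<^bsub>L\<^esub> x) ` right_power F L n"
proof -
  have carr: "carrier (quotient_alg L J) = (\<lambda>x. J +>\<^bsub>L\<^esub> x) ` carrier L"
    by (auto simp: quotient_alg_def A_RCOSETS_def')
  have "right_power F (quotient_alg L J) (Suc m) \<subseteq> (\<lambda>x. J +>\<^bsub>L\<^esub> x) ` right_power F L (Suc m)" for m
  proof (induction m)
    case (Suc m)
    have sub: "right_power F L (Suc m) \<subseteq> carrier L"
      by (rule submoduleE(1)[OF right_power_submodule])
    show ?case
      unfolding right_power.simps(3)
    proof (rule prod_span_minimal)
      show "submodule ((\<lambda>x. J +>\<^bsub>L\<^esub> x) ` prod_span F L (right_power F L (Suc m)) (carrier L)) F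
          (quotient_alg L J)"
        using sub by (intro submodule_quotient_image alg_idealD(1)[OF J] prod_span_submodule) auto
    next
      fix X Y assume "X \<in> right_power F (quotient_alg L J) (Suc m)" "Y \<in> carrier (quotient_alg L J)"
      then obtain x y where xy: "x \<in> right_power F L (Suc m)" "y \<in> carrier L"
        "X = J +>\<^bsub>L\<^esub> x" "Y = J +>\<^bsub>L\<^esub> y"
        unfolding carr using Suc by blast
      then have "X \<otimes>\<^bsub>quotient_alg L J\<^esub> Y = J +>\<^bsub>L\<^esub> (x \<otimes>\<^bsub>L\<^esub> y)"
        using sub by (simp add: quotient_alg_mult[OF J] subset_iff)
      then show "X \<otimes>\<^bsub>quotient_alg L J\<^esub> Y
          \<in> (\<lambda>x. J +>\<^bsub>L\<^esub> x) ` prod_span F L (right_power F L (Suc m)) (carrier L)"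
        using prod_in_prod_span[OF xy(1,2)] by auto
    qed
  qed (simp add: carr)
  then show ?thesis by (cases n) (simp_all add: carr)
qed

text \<open>The projection sends J to the zero coset. An index of the form
  \<open>Suc (Suc n)\<close> makes the power a product span, which contains zero.\<close>

lemma right_power_quotient_trivial:
  assumes J: "alg_ideal F L J" and sub: "right_power F L (Suc (Suc n)) \<subseteq> J"
  shows "right_power F (quotient_alg L J) (Suc (Suc n)) = {\<zero>\<^bsub>quotient_alg L J\<^esub>}"
proof -
  have Jg: "subgroup J (add_monoid L)"
    using alg_idealD(1)[OF J] by (rule submodule.axioms(1))
  have z: "\<zero>\<^bsub>quotient_alg L J\<^esub> = J" by (simp add: quotient_alg_def)
  have "J +>\<^bsub>L\<^esub> x = J" if "x \<in> J" for x
    using that subgroup.subset[OF Jg] Jg by (intro M.a_coset_join2) auto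
  then have "right_power F (quotient_alg L J) (Suc (Suc n)) \<subseteq> {\<zero>\<^bsub>quotient_alg L J\<^esub>}"
    using right_power_quotient_subset[OF J, of "Suc (Suc n)"] sub unfolding z by blast
  moreover have "\<zero>\<^bsub>quotient_alg L J\<^esub> \<in> right_power F (quotient_alg L J) (Suc (Suc n))"
    by (simp add: zero_in_prod_span)
  ultimately show ?thesis by blast
qed

end

section \<open>The abelian ideal inside the intersection, and the bound on the powers\<close>

theorem theoremB:
  fixes F :: "('a, 'm) ring_scheme" and L :: "('a, 'b, 'n) module_scheme"
    and B C :: "'b set"
  assumes "left_pre_lie_algebra F L"
    and "alg_ideal F L B" and "alg_ideal F L C"
    and "carrier L = B <+>\<^bsub>L\<^esub> C"
    and "right_power F (L\<lparr>carrier := B\<rparr>) 3 = {\<zero>\<^bsub>L\<^esub>}"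
    and "right_power F (L\<lparr>carrier := C\<rparr>) 3 = {\<zero>\<^bsub>L\<^esub>}"
  shows "\<exists>J. J \<subseteq> B \<inter> C \<and> alg_ideal F L J \<and> abelian_alg (L\<lparr>carrier := J\<rparr>) \<and>
           right_power F (quotient_alg L J) 6 = {\<zero>\<^bsub>quotient_alg L J\<^esub>}"
proof -
  interpret left_pre_lie_algebra F L by fact
  note B = alg_idealD[OF assms(2)] and C = alg_idealD[OF assms(3)]
  define D where "D = B \<inter> C"
  have D: "alg_ideal F L D" unfolding D_def using assms(2,3) by (rule alg_ideal_Int)
  note D' = alg_idealD[OF D]
  have BL: "B \<subseteq> carrier L" and CL: "C \<subseteq> carrier L" and DL: "D \<subseteq> carrier L"
    using B(1) C(1) D'(1) submoduleE(1) by blast+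
  note B3 = right_power_3_trivial[OF assms(5)] and C3 = right_power_3_trivial[OF assms(6)]
  have split: "\<exists>b\<in>B. \<exists>c\<in>C. x = b \<oplus>\<^bsub>L\<^esub> c" if "x \<in> carrier L" for x
    using that unfolding assms(4) set_add_def' by auto
  \<comment> \<open>Lets a linear condition on an element of L be checked on B and on C
    separately.\<close>
  have split_in: "x \<in> W"
    if "submodule W F L" "x \<in> carrier L" "B \<subseteq> W" "C \<subseteq> W" for x W
    using split[OF that(2)] that submoduleE(5)[OF that(1)] by blast
  define J where "J = prod_span F L D (carrier L)"
  have J: "alg_ideal F L J" unfolding J_def using D by (rule alg_ideal_prod_carrier)
  have JD: "J \<subseteq> D" unfolding J_def using D by (rule alg_ideal_prod_carrier_subset)
  have JD0: "J \<subseteq> {x \<in> carrier L. \<forall>v\<in>D. x \<otimes>\<^bsub>L\<^esub> v \<in> {\<zero>\<^bsub>L\<^esub>}}" (is "_ \<subseteq> ?A")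
    unfolding J_def
  proof (rule prod_span_minimal)
    show A: "submodule ?A F L" using DL by (intro submodule_left_transporter submodule_zero)
    fix d l assume d: "d \<in> D" and l: "l \<in> carrier L"
    have dL: "{d} \<subseteq> carrier L" using d DL by auto
    \<comment> \<open>The condition (d \<cdot> l) \<cdot> v = 0 for all v in D is linear in l. For l
      in B all three factors lie in B, and for l in C all lie in C.\<close>
    have "l \<in> {x \<in> carrier L. \<forall>v\<in>{d}. v \<otimes>\<^bsub>L\<^esub> x \<in> ?A}"
      by (rule split_in[OF submodule_right_transporter[OF A dL] l])
        (use d DL BL CL B3 C3 in \<open>auto simp: D_def intro!: prod_closed\<close>)
    then show "d \<otimes>\<^bsub>L\<^esub> l \<in> ?A" by auto
  qed
  have L3: "(x \<otimes>\<^bsub>L\<^esub> y) \<otimes>\<^bsub>L\<^esub> z \<in> D"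
    if x: "x \<in> carrier L" and y: "y \<in> carrier L" and z: "z \<in> carrier L" for x y z
  proof -
    obtain x1 x2 where x12: "x1 \<in> B" "x2 \<in> C" "x = x1 \<oplus>\<^bsub>L\<^esub> x2" using split[OF x] by blast
    obtain y1 y2 where y12: "y1 \<in> B" "y2 \<in> C" "y = y1 \<oplus>\<^bsub>L\<^esub> y2" using split[OF y] by blast
    obtain z1 z2 where z12: "z1 \<in> B" "z2 \<in> C" "z = z1 \<oplus>\<^bsub>L\<^esub> z2" using split[OF z] by blast
    have c: "x1 \<in> carrier L" "x2 \<in> carrier L" "y1 \<in> carrier L" "y2 \<in> carrier L"
      "z1 \<in> carrier L" "z2 \<in> carrier L"
      using x12 y12 z12 BL CL by auto
    have z0: "\<zero>\<^bsub>L\<^esub> \<in> D" using D'(1) by (rule submodule_zero_closed)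
    \<comment> \<open>Of the eight products, the two pure ones vanish; each mixed one lies in both
      ideals.\<close>
    have 1: "(u \<otimes>\<^bsub>L\<^esub> v) \<otimes>\<^bsub>L\<^esub> w \<in> D"
      if "u \<in> {x1, x2}" "v \<in> {y1, y2}" "w \<in> {z1, z2}" for u v w
      using that x12(1,2) y12(1,2) z12(1,2) c z0 B3 C3
      by (auto simp: D_def B(2,3) C(2,3) prod_closed)
    show ?thesis
      unfolding x12(3) y12(3) z12(3) using c
      by (simp add: prod_add_left prod_add_right prod_closed 1 submoduleE(5)[OF D'(1)])
  qed
  have "right_power F L (Suc (Suc 0)) \<subseteq> {x \<in> carrier L. \<forall>v\<in>carrier L. x \<otimes>\<^bsub>L\<^esub> v \<in> D}"
    unfolding right_power.simps
    by (intro prod_span_minimal submodule_left_transporter D'(1)) (auto intro: L3 prod_closed)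
  then have "right_power F L (Suc (Suc (Suc 0))) \<subseteq> D"
    unfolding right_power.simps(3)[of F L "Suc 0"]
    by (intro prod_span_minimal D'(1)) auto
  then have "right_power F L (Suc (Suc (Suc (Suc 0)))) \<subseteq> J"
    unfolding right_power.simps(3)[of F L "Suc (Suc 0)"]
    by (intro prod_span_minimal alg_idealD(1)[OF J]) (auto simp: J_def intro: prod_in_prod_span)
  \<comment> \<open>J absorbs right multiplication, so the inclusion persists up to the sixth
    power.\<close>
  then have "right_power F L (Suc (Suc (Suc (Suc (Suc 0))))) \<subseteq> J"
    unfolding right_power.simps(3)[of F L "Suc (Suc (Suc 0))"]
    by (intro prod_span_minimal alg_idealD(1)[OF J]) (auto intro: alg_idealD(3)[OF J])
  then have "right_power F L (Suc (Suc (Suc (Suc (Suc (Suc 0)))))) \<subseteq> J"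
    unfolding right_power.simps(3)[of F L "Suc (Suc (Suc (Suc 0)))"]
    by (intro prod_span_minimal alg_idealD(1)[OF J]) (auto intro: alg_idealD(3)[OF J])
  then have "right_power F (quotient_alg L J) 6 = {\<zero>\<^bsub>quotient_alg L J\<^esub>}"
    using right_power_quotient_trivial[OF J, of 4] by (simp add: eval_nat_numeral)
  \<comment> \<open>J annihilates D from the left, and J is contained in D.\<close>
  moreover have "abelian_alg (L\<lparr>carrier := J\<rparr>)"
    using JD0 JD unfolding abelian_alg_def by auto
  ultimately show ?thesis using J JD unfolding D_def by blast
qed

end
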